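(* Define $b(1)=1$ and $b(n)=n+\sum_m b(m)$ for $n>1$, the sum over all proper divisors $m$ of $n$ (positive divisors $m<n$), and let $B(n)=b(n)/n$. Let $p$ and $q$ be distinct primes and $c,d$ nonnegative integers. Then $$B(p^c)=\frac{p-1-(2/p)^c}{p-2}\quad\text{for } p \text{ odd},\qquad B(2^c)=\frac{c+2}{2},$$ $$B(p^cq^d)=\frac12+\frac12\sum_{i=0}^{c}\frac{2^i}{p^i}\sum_{j=0}^{d}\frac{1}{q^j}\sum_{k=0}^{j}\binom{i+k}{k}\binom{j}{k},$$ and, if $q\neq 2$, $$B(2^cq^d)=\frac12+\frac12\sum_{j=0}^{d}\frac{1}{q^j}\sum_{k=0}^{j}\binom{j}{k}\binom{c+k+1}{k+1}.$$
   Context: $b(n)$ is called the sum of recursive divisors of $n$. *)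

theory Defs
  imports Complex_Main "HOL-Computational_Algebra.Primes"
begin

(* The value at 0 is irrelevant; the equation yields 0 there. *)
function rec_divisor_sum :: "nat \<Rightarrow> nat" where
  "rec_divisor_sum n =
     (if n = 1 then 1
      else n + (\<Sum>m\<in>{m. 0 < m \<and> m dvd n \<and> m < n}. rec_divisor_sum m))"
  by pat_completeness auto
termination by (relation "measure id") auto

declare rec_divisor_sum.simps [simp del]

definition rec_divisor_ratio :: "nat \<Rightarrow> real" where
  "rec_divisor_ratio n = real (rec_divisor_sum n) / real n"

end

theory Submission
  imports Defs
begin

text \<open>
  Multiplying \<open>B\<close> out, \<open>b\<close> is the Dirichlet convolution of the identity with the function \<open>H\<close>
  characterised by \<open>(\<Sum>e | e dvd n. H e) = 2 * H n - [n = 1]\<close> (\<open>H\<close> counts ordered factorisations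
  into factors greater than 1), so \<open>B n = (\<Sum>m | m dvd n. H m / m)\<close>. On \<open>p ^ i * q ^ j\<close> the
  function \<open>H\<close> is half of \<open>G i j = 2 ^ i * (\<Sum>k\<le>j. ((i + k) choose k) * (j choose k))\<close>, plus \<open>1/2\<close>
  at the value 1; the characterising equation becomes that \<open>G\<close> sums to \<open>2 * G c d - 1\<close> over the
  rectangle \<open>i \<le> c\<close>, \<open>j \<le> d\<close>.
\<close>

section \<open>Recursive divisor sums as Dirichlet convolutions\<close>

lemma rec_divisor_sum_eq:
  assumes "n > 0"
  shows "rec_divisor_sum n = n + (\<Sum>m\<in>{m. m dvd n} - {n}. rec_divisor_sum m)"
proof -
  have "{m. 0 < m \<and> m dvd n \<and> m < n} = {m. m dvd n} - {n}"
    using assms by (auto dest: dvd_imp_le intro: Nat.gr0I)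
  \<comment> \<open>At n = 1 the sum is empty, so the special value 1 in the definition agrees with
    the general formula.\<close>
  moreover have "{m. m dvd (1::nat)} - {1} = {}"
    by auto
  ultimately show ?thesis
    by (subst rec_divisor_sum.simps) auto
qed

text \<open>Writing m = k * e, both sides run over all pairs (k, e) with k * e dividing n.\<close>

lemma sum_sum_divisors_mult:
  fixes f :: "nat \<Rightarrow> nat \<Rightarrow> 'a::comm_monoid_add"
  assumes "n > 0"
  shows "(\<Sum>m | m dvd n. \<Sum>e | e dvd m. f (m div e) e) =
         (\<Sum>k | k dvd n. \<Sum>e | e dvd n div k. f k e)"
proof -
  have fin: "finite {e. e dvd m}" if "m dvd n" for m
    using that assms by (intro finite_divisors_nat) (auto intro: Nat.gr0I)
  have fin': "finite {e. e dvd n div k}" if "k dvd n" for k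
    using that fin[of "n div k"] by (metis dvd_div_mult_self dvd_triv_left)
  have "(\<Sum>m | m dvd n. \<Sum>e | e dvd m. f (m div e) e) =
        (\<Sum>(m, e)\<in>(SIGMA m:{m. m dvd n}. {e. e dvd m}). f (m div e) e)"
    using fin by (subst sum.Sigma) auto
  also have "\<dots> = (\<Sum>(k, e)\<in>(SIGMA k:{k. k dvd n}. {e. e dvd n div k}). f k e)"
    by (rule sum.reindex_bij_witness
          [where i = "\<lambda>(k, e). (k * e, e)" and j = "\<lambda>(m, e). (m div e, e)"])
       (use assms in \<open>auto elim!: dvdE simp: mult_ac\<close>)
  also have "\<dots> = (\<Sum>k | k dvd n. \<Sum>e | e dvd n div k. f k e)"
    using fin fin' by (subst sum.Sigma) auto
  finally show ?thesis .
qed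

lemma sum_divisors_flip:
  fixes f :: "nat \<Rightarrow> 'a::comm_monoid_add"
  assumes "n > 0"
  shows "(\<Sum>k | k dvd n. f (n div k)) = (\<Sum>k | k dvd n. f k)"
  by (rule sum.reindex_bij_witness[where i = "\<lambda>k. n div k" and j = "\<lambda>k. n div k"])
     (use assms in \<open>auto elim!: dvdE\<close>)

text \<open>Let g = id * H as a convolution. Summing over divisors is convolution with 1, and 1 * H
  = 2 H - \<delta>, so the divisor sum of g is id * (2 H - \<delta>) = 2 g - id. Hence g obeys the
  recursion of \<open>rec_divisor_sum\<close>.\<close>

lemma rec_divisor_sum_eq_convolution:
  fixes H :: "nat \<Rightarrow> real"
  assumes "n > 0"
    and H: "\<And>m. m dvd n \<Longrightarrow> (\<Sum>e | e dvd m. H e) = 2 * H m - of_bool (m = 1)"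
  shows "real (rec_divisor_sum n) = (\<Sum>e | e dvd n. real (n div e) * H e)"
  using assms
proof (induction n rule: less_induct)
  case (less n)
  define g where "g m = (\<Sum>e | e dvd m. real (m div e) * H e)" for m
  have fin: "finite {m. m dvd n}"
    using less.prems(1) by (rule finite_divisors_nat)
  have IH: "real (rec_divisor_sum m) = g m" if "m \<in> {m. m dvd n} - {n}" for m
    unfolding g_def
  proof (rule less.IH)
    show "m < n" "m > 0"
      using that less.prems(1) by (auto dest: dvd_imp_le intro!: Nat.gr0I le_neq_trans)
  next
    fix k assume "k dvd m"
    with that show "(\<Sum>e | e dvd k. H e) = 2 * H k - of_bool (k = 1)"
      by (intro less.prems(2)) auto
  qed
  have "(\<Sum>m | m dvd n. g m) = (\<Sum>k | k dvd n. \<Sum>e | e dvd n div k. real k * H e)"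
    unfolding g_def using sum_sum_divisors_mult[OF less.prems(1)] .
  \<comment> \<open>The term [n div k = 1] survives only at k = n.\<close>
  also have "\<dots> = (\<Sum>k | k dvd n. real k * (2 * H (n div k)) - (if k = n then real n else 0))"
  proof (rule sum.cong)
    fix k assume "k \<in> {k. k dvd n}"
    then have "k dvd n" and "n div k = 1 \<longleftrightarrow> k = n"
      using less.prems(1) by (auto elim!: dvdE)
    moreover have "n div k dvd n"
      using \<open>k dvd n\<close> by (metis dvd_div_mult_self dvd_triv_left)
    ultimately show "(\<Sum>e | e dvd n div k. real k * H e) =
        real k * (2 * H (n div k)) - (if k = n then real n else 0)"
      using less.prems(2)[of "n div k"]
      by (simp add: sum_distrib_left[symmetric] right_diff_distrib)
  qed simp
  also have "\<dots> = 2 * (\<Sum>k | k dvd n. real k * H (n div k)) - real n"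
    using fin by (simp add: sum_subtractf sum_distrib_left mult_ac)
  also have "(\<Sum>k | k dvd n. real k * H (n div k)) = (\<Sum>k | k dvd n. real (n div (n div k)) * H (n div k))"
    using less.prems(1) by (intro sum.cong) (auto elim!: dvdE)
  also have "\<dots> = g n"
    unfolding g_def using sum_divisors_flip[OF less.prems(1), of "\<lambda>k. real (n div k) * H k"] .
  finally have *: "(\<Sum>m | m dvd n. g m) = 2 * g n - real n" .
  have "real (rec_divisor_sum n) = real n + (\<Sum>m\<in>{m. m dvd n} - {n}. g m)"
    by (subst rec_divisor_sum_eq[OF less.prems(1)]) (simp add: IH)
  also have "\<dots> = g n"
    using * fin by (simp add: sum_diff1)
  finally show ?case
    by (simp add: g_def)
qed

lemma rec_divisor_ratio_eq_sum:
  fixes H :: "nat \<Rightarrow> real"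
  assumes "n > 0"
    and "\<And>m. m dvd n \<Longrightarrow> (\<Sum>e | e dvd m. H e) = 2 * H m - of_bool (m = 1)"
  shows "rec_divisor_ratio n = (\<Sum>e | e dvd n. H e / real e)"
proof -
  have "real (rec_divisor_sum n) = (\<Sum>e | e dvd n. real (n div e) * H e)"
    by (rule rec_divisor_sum_eq_convolution) (use assms in auto)
  then show ?thesis
    unfolding rec_divisor_ratio_def
    by (simp add: sum_divide_distrib) (intro sum.cong, use assms(1) in \<open>auto simp: real_of_nat_div\<close>)
qed

section \<open>Divisors of a product of two prime powers\<close>

lemma multiplicity_prime_power_mult:
  fixes p q :: nat
  assumes "prime p" "prime q" "p \<noteq> q"
  shows "multiplicity p (p ^ i * q ^ j) = i" "multiplicity q (p ^ i * q ^ j) = j"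
  using assms
  by (simp_all add: prime_elem_multiplicity_mult_distrib prime_gt_0_nat
        multiplicity_distinct_prime_power)

lemma bij_betw_divisors_prime_power_mult:
  fixes p q :: nat
  assumes "prime p" "prime q" "p \<noteq> q"
  shows "bij_betw (\<lambda>(i, j). p ^ i * q ^ j) ({..c} \<times> {..d}) {m. m dvd p ^ c * q ^ d}"
proof (rule bij_betw_imageI)
  show "inj_on (\<lambda>(i, j). p ^ i * q ^ j) ({..c} \<times> {..d})"
    by (rule inj_on_inverseI[where g = "\<lambda>m. (multiplicity p m, multiplicity q m)"])
       (auto simp: multiplicity_prime_power_mult[OF assms])
  show "(\<lambda>(i, j). p ^ i * q ^ j) ` ({..c} \<times> {..d}) = {m. m dvd p ^ c * q ^ d}"
  proof (intro equalityI subsetI)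
    fix m assume "m \<in> {m. m dvd p ^ c * q ^ d}"
    then obtain a b where "m = a * b" "a dvd p ^ c" "b dvd q ^ d"
      using division_decomp[of m "p ^ c" "q ^ d"] by blast
    then show "m \<in> (\<lambda>(i, j). p ^ i * q ^ j) ` ({..c} \<times> {..d})"
      using assms by (auto simp: divides_primepow_nat)
  qed (auto intro!: mult_dvd_mono le_imp_power_dvd)
qed

lemma sum_divisors_prime_power_mult:
  fixes p q :: nat and f :: "nat \<Rightarrow> 'a::comm_monoid_add"
  assumes "prime p" "prime q" "p \<noteq> q"
  shows "(\<Sum>m | m dvd p ^ c * q ^ d. f m) = (\<Sum>i\<le>c. \<Sum>j\<le>d. f (p ^ i * q ^ j))"
  using sum.reindex_bij_betw[OF bij_betw_divisors_prime_power_mult[OF assms], of f c d]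
  by (simp add: sum.cartesian_product case_prod_unfold)

section \<open>Identities for the binomial sums, with the factor \<open>2 ^ i\<close> of
  \<open>G\<close> left out\<close>

definition binom_sum :: "nat \<Rightarrow> nat \<Rightarrow> nat" where
  "binom_sum i j = (\<Sum>k\<le>j. ((i + k) choose k) * (j choose k))"

lemma binom_sum_0_left: "binom_sum 0 j = 2 ^ j"
  by (simp add: binom_sum_def choose_row_sum)

lemma binom_sum_0_right [simp]: "binom_sum i 0 = 1"
  by (simp add: binom_sum_def)

lemma sum_binom_sum:
  "(\<Sum>j\<le>d. binom_sum i j) = (\<Sum>k\<le>d. ((i + k) choose k) * (Suc d choose Suc k))"
proof -
  have "(\<Sum>j\<le>d. binom_sum i j) = (\<Sum>j\<le>d. \<Sum>k\<le>d. ((i + k) choose k) * (j choose k))"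
    unfolding binom_sum_def
    by (intro sum.cong refl sum.mono_neutral_left) (auto simp: not_le)
  also have "\<dots> = (\<Sum>k\<le>d. ((i + k) choose k) * (\<Sum>j\<le>d. j choose k))"
    by (subst sum.swap) (simp add: sum_distrib_left)
  \<comment> \<open>The hockey-stick identity, stated between functions because k is bound in the
    outer sum.\<close>
  also have "(\<lambda>k. \<Sum>j\<le>d. j choose k) = (\<lambda>k. Suc d choose Suc k)"
    by (induction d) (simp_all add: fun_eq_iff)
  finally show ?thesis .
qed

text \<open>Pascal's rule on \<open>Suc d choose Suc k\<close> splits the row sum, and Pascal's rule
  on \<open>(Suc i + Suc k) choose Suc k\<close> splits \<open>binom_sum (Suc i) d\<close>. Both
  leave the same remainder \<open>t\<close>, which is eliminated.\<close>

lemma sum_binom_sum_Suc: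
  "(\<Sum>j\<le>d. binom_sum (Suc i) j) + binom_sum i d = 2 * binom_sum (Suc i) d"
proof -
  define t where "t = (\<Sum>k\<le>d. ((Suc i + k) choose k) * (d choose Suc k))"
  have "(\<Sum>j\<le>d. binom_sum (Suc i) j) = binom_sum (Suc i) d + t"
    unfolding sum_binom_sum by (simp add: binom_sum_def t_def distrib_left sum.distrib)
  moreover have "binom_sum (Suc i) d = binom_sum i d + t"
  proof (cases d)
    case (Suc e)
    have "binom_sum (Suc i) d = 1 + (\<Sum>k\<le>e. ((Suc i + Suc k) choose Suc k) * (d choose Suc k))"
      by (simp add: binom_sum_def Suc sum.atMost_Suc_shift del: sum.atMost_Suc binomial_Suc_Suc)
    also have "\<dots> = 1 + (\<Sum>k\<le>e. ((i + Suc k) choose Suc k) * (d choose Suc k)) +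
        (\<Sum>k\<le>e. ((Suc i + k) choose k) * (d choose Suc k))"
      by (simp add: sum.distrib distrib_right algebra_simps)
    also have "1 + (\<Sum>k\<le>e. ((i + Suc k) choose Suc k) * (d choose Suc k)) = binom_sum i d"
      by (simp add: binom_sum_def Suc sum.atMost_Suc_shift del: sum.atMost_Suc binomial_Suc_Suc)
    \<comment> \<open>The last term of \<open>t\<close>, at k = d, contains
      \<open>d choose Suc d\<close> = 0.\<close>
    also have "(\<Sum>k\<le>e. ((Suc i + k) choose k) * (d choose Suc k)) = t"
      by (simp add: t_def Suc)
    finally show ?thesis .
  qed (simp add: t_def)
  ultimately show ?thesis
    by simp
qed

text \<open>Row 0 is a geometric sum. Each further row adds the preceding identity times
  \<open>2 ^ Suc c\<close>, which telescopes.\<close>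

lemma sum_rectangle_binom_sum:
  "(\<Sum>i\<le>c. \<Sum>j\<le>d. 2 ^ i * binom_sum i j) + 1 = 2 * 2 ^ c * binom_sum c d"
proof (induction c)
  case 0
  show ?case
    by (induction d) (simp_all add: binom_sum_0_left)
next
  case (Suc c)
  have "2 ^ Suc c * (\<Sum>j\<le>d. binom_sum (Suc c) j) + 2 ^ Suc c * binom_sum c d =
      2 ^ Suc c * (2 * binom_sum (Suc c) d)"
    unfolding distrib_left[symmetric] sum_binom_sum_Suc ..
  with Suc show ?case
    by (simp add: sum_distrib_left)
qed

section \<open>The ratio at prime powers and their products\<close>

lemma rec_divisor_ratio_prime_power_mult:
  fixes p q c d :: nat
  assumes pq: "prime p" "prime q" "p \<noteq> q"
  shows "rec_divisor_ratio (p ^ c * q ^ d) =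
    1 / 2 + 1 / 2 * (\<Sum>i\<le>c. \<Sum>j\<le>d. 2 ^ i * real (binom_sum i j) / (real p ^ i * real q ^ j))"
proof -
  define G where "G i j = 2 ^ i * binom_sum i j" for i j
  define H where
    "H m = (real (G (multiplicity p m) (multiplicity q m)) + of_bool (m = 1)) / 2" for m
  have H_eq: "H (p ^ i * q ^ j) = (real (G i j) + of_bool (i = 0 \<and> j = 0)) / 2" for i j
  proof -
    have "p ^ i * q ^ j = 1 \<longleftrightarrow> i = 0 \<and> j = 0"
      using pq by (auto dest: prime_gt_1_nat)
    then show ?thesis
      by (simp add: H_def multiplicity_prime_power_mult[OF pq])
  qed
  \<comment> \<open>The correction at 1 counts once. It is used with f = 1 to check the equation for
    \<open>H\<close>, and with f i j = p^i q^j for the ratio, where it yields the leading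
    1/2.\<close>
  have delta: "(\<Sum>i\<le>c. \<Sum>j\<le>d. of_bool (i = 0 \<and> j = 0) / f i j) = (1::real)"
    if "f 0 0 = 1" for c d :: nat and f
  proof -
    have "(\<Sum>i\<le>c. \<Sum>j\<le>d. of_bool (i = 0 \<and> j = 0) / f i j) =
        (\<Sum>i\<le>c. \<Sum>j\<le>d. if j = 0 then if i = 0 then 1 else 0 else 0)"
      using that by (intro sum.cong) auto
    then show ?thesis
      by simp
  qed
  have rect: "(\<Sum>i\<le>c. \<Sum>j\<le>d. real (G i j)) + 1 = 2 * real (G c d)" for c d
    using arg_cong[OF sum_rectangle_binom_sum[of d c], of real] by (simp add: G_def)
  have "(\<Sum>e | e dvd m. H e) = 2 * H m - of_bool (m = 1)" if m: "m dvd p ^ c * q ^ d" for m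
  proof -
    have "m \<in> (\<lambda>(i, j). p ^ i * q ^ j) ` ({..c} \<times> {..d})"
      using bij_betw_imp_surj_on[OF bij_betw_divisors_prime_power_mult[OF pq]] m by simp
    then obtain i j where ij: "m = p ^ i * q ^ j"
      by auto
    have "(\<Sum>e | e dvd m. H e) = real (G i j)"
      using rect[of j i] delta[of "\<lambda>_ _. 1" j i]
      by (simp add: ij sum_divisors_prime_power_mult[OF pq] H_eq sum.distrib
          flip: sum_divide_distrib)
    also have "\<dots> = 2 * H m - of_bool (m = 1)"
      by (simp add: H_def ij multiplicity_prime_power_mult[OF pq] add_divide_distrib)
    finally show ?thesis .
  qed
  moreover have "p ^ c * q ^ d > 0"
    using pq by (simp add: prime_gt_0_nat)
  ultimately have "rec_divisor_ratio (p ^ c * q ^ d) =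
      (\<Sum>i\<le>c. \<Sum>j\<le>d. H (p ^ i * q ^ j) / real (p ^ i * q ^ j))"
    by (simp add: rec_divisor_ratio_eq_sum[of _ H] sum_divisors_prime_power_mult[OF pq])
  also have "\<dots> = 1 / 2 * (\<Sum>i\<le>c. \<Sum>j\<le>d. real (G i j) / (real p ^ i * real q ^ j)) +
      1 / 2 * (\<Sum>i\<le>c. \<Sum>j\<le>d. of_bool (i = 0 \<and> j = 0) / (real p ^ i * real q ^ j))"
    by (simp add: H_eq sum.distrib[symmetric] sum_distrib_left add_divide_distrib del: of_bool_conj)
  also have "(\<Sum>i\<le>c. \<Sum>j\<le>d. of_bool (i = 0 \<and> j = 0) / (real p ^ i * real q ^ j)) = 1"
    by (rule delta) simp
  finally show ?thesis
    by (simp add: G_def)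
qed

lemma rec_divisor_ratio_prime_power:
  fixes p c :: nat
  assumes "prime p"
  shows "rec_divisor_ratio (p ^ c) = 1 / 2 + 1 / 2 * (\<Sum>i\<le>c. (2 / real p) ^ i)"
proof -
  \<comment> \<open>Any other prime will do, since it enters with exponent 0.\<close>
  obtain q :: nat where "prime q" "p \<noteq> q"
    using bigger_prime[of p] by auto
  then show ?thesis
    using rec_divisor_ratio_prime_power_mult[OF assms, of q c 0] by (simp add: power_divide)
qed

theorem theorem7:
  fixes p q c d :: nat
  assumes "prime p" and "prime q" and "p \<noteq> q"
  shows "(odd p \<longrightarrow>
           rec_divisor_ratio (p ^ c) = (real p - 1 - (2 / real p) ^ c) / (real p - 2)) \<and>
         rec_divisor_ratio (2 ^ c) = (real c + 2) / 2 \<and>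
         rec_divisor_ratio (p ^ c * q ^ d) =
           1 / 2 + 1 / 2 * (\<Sum>i=0..c. 2 ^ i / real p ^ i *
             (\<Sum>j=0..d. 1 / real q ^ j *
               (\<Sum>k=0..j. real ((i + k) choose k) * real (j choose k)))) \<and>
         (q \<noteq> 2 \<longrightarrow>
           rec_divisor_ratio (2 ^ c * q ^ d) =
             1 / 2 + 1 / 2 * (\<Sum>j=0..d. 1 / real q ^ j *
               (\<Sum>k=0..j. real (j choose k) * real ((c + k + 1) choose (k + 1)))))"
proof (intro conjI impI)
  assume "odd p"
  \<comment> \<open>This makes the ratio 2 / p of the geometric sum different from 1.\<close>
  then have "real p \<noteq> 2" "real p \<noteq> 0"
    using assms(1) by (auto dest: prime_gt_0_nat)
  then show "rec_divisor_ratio (p ^ c) = (real p - 1 - (2 / real p) ^ c) / (real p - 2)"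
    unfolding rec_divisor_ratio_prime_power[OF assms(1)]
    by (subst sum_gp0) (auto simp: divide_simps, simp add: algebra_simps)
next
  show "rec_divisor_ratio (2 ^ c) = (real c + 2) / 2"
    using rec_divisor_ratio_prime_power[OF two_is_prime_nat, of c] by simp
next
  show "rec_divisor_ratio (p ^ c * q ^ d) =
      1 / 2 + 1 / 2 * (\<Sum>i=0..c. 2 ^ i / real p ^ i *
        (\<Sum>j=0..d. 1 / real q ^ j * (\<Sum>k=0..j. real ((i + k) choose k) * real (j choose k))))"
    unfolding rec_divisor_ratio_prime_power_mult[OF assms]
    by (simp add: binom_sum_def atLeast0AtMost sum_distrib_left sum_divide_distrib mult_ac)
next
  assume "q \<noteq> 2"
  \<comment> \<open>For p = 2 the powers \<open>2 ^ i\<close> cancel against \<open>p ^ i\<close>,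
    so i occurs only in the binomials and the sum over i has a closed form, again by a hockey-stick
    identity.\<close>
  have "(\<Sum>i\<le>c. \<Sum>j\<le>d. real (binom_sum i j) / real q ^ j) =
      (\<Sum>j\<le>d. 1 / real q ^ j * real (\<Sum>i\<le>c. binom_sum i j))"
    by (subst sum.swap) (simp add: sum_divide_distrib)
  also have "(\<lambda>j. \<Sum>i\<le>c. binom_sum i j) =
      (\<lambda>j. \<Sum>k\<le>j. (j choose k) * ((c + k + 1) choose (k + 1)))"
  proof
    fix j
    have "(\<Sum>i\<le>c. (i + k) choose k) = (c + k + 1) choose (k + 1)" for k
      by (induction c) simp_all
    then show "(\<Sum>i\<le>c. binom_sum i j) = (\<Sum>k\<le>j. (j choose k) * ((c + k + 1) choose (k + 1)))"
      unfolding binom_sum_def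
      by (subst sum.swap) (simp add: sum_distrib_left[symmetric] mult.commute)
  qed
  finally show "rec_divisor_ratio (2 ^ c * q ^ d) =
      1 / 2 + 1 / 2 * (\<Sum>j=0..d. 1 / real q ^ j *
        (\<Sum>k=0..j. real (j choose k) * real ((c + k + 1) choose (k + 1))))"
    using rec_divisor_ratio_prime_power_mult[OF two_is_prime_nat assms(2), of c d] \<open>q \<noteq> 2\<close>
    by (simp add: atLeast0AtMost)
qed

end
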